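(* Let $A$ be a finite set of alternatives and let $\mathcal D\subseteq\mathcal L(A)$ be a Condorcet domain. Then $\mathcal D$ is a peak-pit maximal Condorcet domain if and only if $\mathcal D$ is a maximal peak-pit Condorcet domain.
   Context: $\mathcal L(A)$ is the set of linear orders on the finite set $A$; a linear order is written as a word listing alternatives from top to bottom. For $B\subseteq A$ and a domain $\mathcal D\subseteq\mathcal L(A)$, $\mathcal D_B=\{R_B:R\in\mathcal D\}$ where $R_B$ is the restriction of $R$ to $B$. For distinct $a,b,c$, $x\in\{a,b,c\}$, $k\in\{1,2,3\}$, $\mathcal D_{\{a,b,c\}}$ satisfies the never-condition $xN_{\{a,b,c\}}k$ if no $x_1x_2x_3\in\mathcal D_{\{a,b,c\}}$ has $x_k=x$ ($k=1$ never-top, $k=3$ never-bottom, $k=2$ never-middle). $\mathcal D$ is a Condorcet domain if for every triple of distinct alternatives $\mathcal D_{\{a,b,c\}}$ satisfies some never-condition, and a peak-pit Condorcet domain if for every triple it satisfies some never-top or never-bottom condition. A peak-pit Condorcet domain $\mathcal D$ is a peak-pit maximal Condorcet domain if every Condorcet domain $\mathcal D'\subseteq\mathcal L(A)$ with $\mathcal D\subseteq\mathcal D'$ equals $\mathcal D$; it is a maximal peak-pit Condorcet domain if every peak-pit Condorcet domain $\mathcal D'\subseteq\mathcal L(A)$ with $\mathcal D\subseteq\mathcal D'$ equals $\mathcal D$. *)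

theory Defs
  imports Main
begin

text \<open>
  A ranking is a reflexive relation \<open>R\<close>, with \<open>(x, y) \<in> R\<close> meaning that \<open>x\<close> is ranked
  at least as high as \<open>y\<close>.
\<close>

definition linear_orders :: "'a set \<Rightarrow> 'a rel set" where
  "linear_orders A = {R. linear_order_on A R}"

definition restrict_domain :: "'a rel set \<Rightarrow> 'a set \<Rightarrow> 'a rel set" where
  "restrict_domain D B = (\<lambda>R. Restr R B) ` D"

text \<open>The linear order on \<open>set w\<close> that the word \<open>w\<close> lists from top to bottom.\<close>

definition order_of_word :: "'a list \<Rightarrow> 'a rel" where
  "order_of_word w = {(w ! i, w ! j) | i j. i \<le> j \<and> j < length w}"

text \<open>
  The never-condition \<open>x N k\<close> for a set \<open>E\<close> of linear orders on a three-element set.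
  Positions \<open>k\<close> count from 1, list indices from 0.
\<close>

definition never_condition :: "'a rel set \<Rightarrow> 'a \<Rightarrow> nat \<Rightarrow> bool" where
  "never_condition E x k \<longleftrightarrow>
     \<not> (\<exists>x1 x2 x3. distinct [x1, x2, x3] \<and> order_of_word [x1, x2, x3] \<in> E
          \<and> [x1, x2, x3] ! (k - 1) = x)"

definition Condorcet_domain :: "'a set \<Rightarrow> 'a rel set \<Rightarrow> bool" where
  "Condorcet_domain A D \<longleftrightarrow> D \<subseteq> linear_orders A \<and>
     (\<forall>a\<in>A. \<forall>b\<in>A. \<forall>c\<in>A. distinct [a, b, c] \<longrightarrow>
        (\<exists>x\<in>{a, b, c}. \<exists>k\<in>{1, 2, 3}. never_condition (restrict_domain D {a, b, c}) x k))"

definition peak_pit_Condorcet_domain :: "'a set \<Rightarrow> 'a rel set \<Rightarrow> bool" where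
  "peak_pit_Condorcet_domain A D \<longleftrightarrow> D \<subseteq> linear_orders A \<and>
     (\<forall>a\<in>A. \<forall>b\<in>A. \<forall>c\<in>A. distinct [a, b, c] \<longrightarrow>
        (\<exists>x\<in>{a, b, c}. \<exists>k\<in>{1, 3}. never_condition (restrict_domain D {a, b, c}) x k))"

definition peak_pit_maximal_Condorcet_domain :: "'a set \<Rightarrow> 'a rel set \<Rightarrow> bool" where
  "peak_pit_maximal_Condorcet_domain A D \<longleftrightarrow> peak_pit_Condorcet_domain A D \<and>
     (\<forall>D'. D' \<subseteq> linear_orders A \<longrightarrow> Condorcet_domain A D' \<longrightarrow> D \<subseteq> D' \<longrightarrow> D' = D)"

definition maximal_peak_pit_Condorcet_domain :: "'a set \<Rightarrow> 'a rel set \<Rightarrow> bool" where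
  "maximal_peak_pit_Condorcet_domain A D \<longleftrightarrow> peak_pit_Condorcet_domain A D \<and>
     (\<forall>D'. D' \<subseteq> linear_orders A \<longrightarrow> peak_pit_Condorcet_domain A D' \<longrightarrow> D \<subseteq> D' \<longrightarrow> D' = D)"

end

theory Submission
  imports Defs
begin

text \<open>
  If adding an order to a maximal peak-pit domain \<open>D\<close> yields a Condorcet domain that is not
  peak-pit, then on some triple \<open>x, y, z\<close> the alternative \<open>x\<close> is never in the middle and
  three of the four remaining orders come from \<open>D\<close>. Hence the pairs \<open>(x, y)\<close> and
  \<open>(x, z)\<close> split \<open>D\<close> in the same nontrivial way. This is impossible: if \<open>P, Q\<close> are
  closest elements on the two sides of the split, then swapping an adjacent pair of \<open>P\<close> that
  is inverted in \<open>Q\<close> gives an order that can be added to \<open>D\<close>, and it lies strictly between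
  \<open>P\<close> and \<open>Q\<close>.
\<close>

section \<open>Never-conditions expressed on whole orders\<close>

text \<open>Phrased with the unrestricted orders of \<open>D\<close>, so that words can be left
  behind; by reflexivity the case \<open>y = x\<close> is harmless.\<close>

definition never_top :: "'a rel set \<Rightarrow> 'a \<Rightarrow> 'a set \<Rightarrow> bool" where
  "never_top D x B \<longleftrightarrow> \<not> (\<exists>R\<in>D. \<forall>y\<in>B. (x, y) \<in> R)"

definition never_bottom :: "'a rel set \<Rightarrow> 'a \<Rightarrow> 'a set \<Rightarrow> bool" where
  "never_bottom D x B \<longleftrightarrow> \<not> (\<exists>R\<in>D. \<forall>y\<in>B. (y, x) \<in> R)"

text \<open>Here \<open>x\<close> is excluded from both ranges, because by reflexivity
  \<open>y = z = x\<close> would always be a witness.\<close>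

definition never_middle :: "'a rel set \<Rightarrow> 'a \<Rightarrow> 'a set \<Rightarrow> bool" where
  "never_middle D x B \<longleftrightarrow>
     \<not> (\<exists>R\<in>D. \<exists>y\<in>B - {x}. \<exists>z\<in>B - {x}. (y, x) \<in> R \<and> (x, z) \<in> R)"

definition peak_pit_on :: "'a rel set \<Rightarrow> 'a set \<Rightarrow> bool" where
  "peak_pit_on D B \<longleftrightarrow> (\<exists>x\<in>B. never_top D x B \<or> never_bottom D x B)"

section \<open>Basic facts on linear orders\<close>

lemma linear_orders_refl: "R \<in> linear_orders A \<Longrightarrow> x \<in> A \<Longrightarrow> (x, x) \<in> R"
  by (auto simp: linear_orders_def order_on_defs refl_on_def)

lemma linear_orders_not_iff:
  "R \<in> linear_orders A \<Longrightarrow> x \<in> A \<Longrightarrow> y \<in> A \<Longrightarrow> x \<noteq> y \<Longrightarrow> (x, y) \<notin> R \<longleftrightarrow> (y, x) \<in> R"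
  by (auto simp: linear_orders_def order_on_defs total_on_def antisym_def)

lemma linear_orders_trans:
  "R \<in> linear_orders A \<Longrightarrow> (x, y) \<in> R \<Longrightarrow> (y, z) \<in> R \<Longrightarrow> (x, z) \<in> R"
  by (auto simp: linear_orders_def order_on_defs dest: transD)

lemma linear_orders_subset: "R \<in> linear_orders A \<Longrightarrow> R \<subseteq> A \<times> A"
  by (auto simp: linear_orders_def order_on_defs)

text \<open>Transitivity is asked for distinct triples only, which is where conditions on triples
  can supply it; the single equivalence covers both totality and antisymmetry.\<close>

lemma linear_ordersI:
  assumes "R \<subseteq> A \<times> A"
    and "\<And>x. x \<in> A \<Longrightarrow> (x, x) \<in> R"
    and "\<And>x y. x \<in> A \<Longrightarrow> y \<in> A \<Longrightarrow> x \<noteq> y \<Longrightarrow> (x, y) \<notin> R \<longleftrightarrow> (y, x) \<in> R"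
    and "\<And>x y z. x \<in> A \<Longrightarrow> y \<in> A \<Longrightarrow> z \<in> A \<Longrightarrow> distinct [x, y, z] \<Longrightarrow>
           (x, y) \<in> R \<Longrightarrow> (y, z) \<in> R \<Longrightarrow> (x, z) \<in> R"
  shows "R \<in> linear_orders A"
proof -
  have "antisym R"
    using assms(1,3) unfolding antisym_def by blast
  moreover have "trans R"
  proof (rule transI)
    fix x y z assume xy: "(x, y) \<in> R" and yz: "(y, z) \<in> R"
    then have "x \<in> A" "y \<in> A" "z \<in> A" using assms(1) by auto
    then show "(x, z) \<in> R"
      using assms(2)[of x] assms(3)[of x y] assms(4)[of x y z] xy yz by (cases "distinct [x, y, z]") auto
  qed
  moreover have "total_on A R"
    using assms(3) unfolding total_on_def by blast
  moreover have "refl_on A R"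
    using assms(2) unfolding refl_on_def by blast
  ultimately show ?thesis
    using assms(1) by (simp add: linear_orders_def order_on_defs)
qed

section \<open>Translation of never-conditions from words to relations\<close>

lemma order_of_word_3:
  "order_of_word [x, y, z] = {(x, x), (y, y), (z, z), (x, y), (x, z), (y, z)}"
proof -
  have "{(i, j). i \<le> j \<and> j < (3::nat)} = {(0, 0), (1, 1), (2, 2), (0, 1), (0, 2), (1, 2)}"
    by auto
  moreover have "order_of_word [x, y, z] =
      (\<lambda>(i, j). ([x, y, z] ! i, [x, y, z] ! j)) ` {(i, j). i \<le> j \<and> j < 3}"
    unfolding order_of_word_def image_def by (auto simp: numeral_3_eq_3)
  ultimately show ?thesis by simp
qed

text \<open>Comparing fields recovers the set of alternatives; conversely, two consecutive
  comparisons fix an order on a triple by transitivity and antisymmetry.\<close>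

lemma order_of_word_eq_Restr_iff:
  assumes "R \<in> linear_orders A" "a \<in> A" "b \<in> A" "c \<in> A" "distinct [a, b, c]" "distinct [x, y, z]"
  shows "order_of_word [x, y, z] = Restr R {a, b, c} \<longleftrightarrow>
    {x, y, z} = {a, b, c} \<and> (x, y) \<in> R \<and> (y, z) \<in> R"
proof
  assume eq: "order_of_word [x, y, z] = Restr R {a, b, c}"
  have "Field (order_of_word [x, y, z]) = {x, y, z}"
    by (auto simp: order_of_word_3 Field_def)
  moreover have "Field (Restr R {a, b, c}) = {a, b, c}"
    using assms linear_orders_refl[OF assms(1)] by (auto simp: Field_def)
  moreover have "(x, y) \<in> R" "(y, z) \<in> R"
    using eq by (auto simp: order_of_word_3)
  ultimately show "{x, y, z} = {a, b, c} \<and> (x, y) \<in> R \<and> (y, z) \<in> R"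
    using eq by simp
next
  assume *: "{x, y, z} = {a, b, c} \<and> (x, y) \<in> R \<and> (y, z) \<in> R"
  then have "{x, y, z} \<subseteq> A" using assms(2-4) by simp
  then have A: "x \<in> A" "y \<in> A" "z \<in> A" by auto
  have "(x, y) \<in> R" "(y, z) \<in> R" "(x, z) \<in> R"
    using * linear_orders_trans[OF assms(1)] by blast+
  moreover from this have "(y, x) \<notin> R" "(z, y) \<notin> R" "(z, x) \<notin> R"
    using linear_orders_not_iff[OF assms(1)] A assms(6) by auto
  ultimately have "order_of_word [x, y, z] = Restr R {x, y, z}"
    using A linear_orders_refl[OF assms(1)] unfolding order_of_word_3 by auto
  then show "order_of_word [x, y, z] = Restr R {a, b, c}" using * by simp
qed

lemma never_condition_iff:
  assumes "D \<subseteq> linear_orders A" "a \<in> A" "b \<in> A" "c \<in> A" "distinct [a, b, c]"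
  shows "never_condition (restrict_domain D {a, b, c}) w k \<longleftrightarrow>
    \<not> (\<exists>R\<in>D. \<exists>x y z. distinct [x, y, z] \<and> {x, y, z} = {a, b, c} \<and>
         (x, y) \<in> R \<and> (y, z) \<in> R \<and> [x, y, z] ! (k - 1) = w)"
proof -
  define E where "E x y z R \<longleftrightarrow> {x, y, z} = {a, b, c} \<and> (x, y) \<in> R \<and> (y, z) \<in> R" for x y z R
  have "order_of_word [x, y, z] \<in> restrict_domain D {a, b, c} \<longleftrightarrow> (\<exists>R\<in>D. E x y z R)"
    if "distinct [x, y, z]" for x y z
    unfolding restrict_domain_def image_iff E_def
    by (intro bex_cong refl order_of_word_eq_Restr_iff) (use assms that in auto)
  then have "never_condition (restrict_domain D {a, b, c}) w k \<longleftrightarrow>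
      \<not> (\<exists>R\<in>D. \<exists>x y z. distinct [x, y, z] \<and> E x y z R \<and> [x, y, z] ! (k - 1) = w)"
    unfolding never_condition_def by metis
  then show ?thesis unfolding E_def by (simp only: conj_assoc)
qed

lemma three_set_cases:
  assumes "x \<in> {a, b, c}" "distinct [a, b, c]"
  obtains y z where "distinct [x, y, z]" "{a, b, c} = {x, y, z}"
proof -
  consider "x = a" | "x = b" | "x = c" using assms by blast
  then show thesis
    using assms that[of b c] that[of a c] that[of a b] by cases auto
qed

lemma never_condition_1_iff:
  assumes "D \<subseteq> linear_orders A" "a \<in> A" "b \<in> A" "c \<in> A" "distinct [a, b, c]" "w \<in> {a, b, c}"
  shows "never_condition (restrict_domain D {a, b, c}) w 1 \<longleftrightarrow> never_top D w {a, b, c}"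
proof -
  have key: "(\<exists>x y z. distinct [x, y, z] \<and> {x, y, z} = {a, b, c} \<and>
         (x, y) \<in> R \<and> (y, z) \<in> R \<and> [x, y, z] ! (1 - 1) = w) \<longleftrightarrow> (\<forall>y\<in>{a, b, c}. (w, y) \<in> R)"
    (is "?L \<longleftrightarrow> ?R") if "R \<in> D" for R
  proof -
    have R: "R \<in> linear_orders A" using assms(1) that by auto
    show ?thesis
    proof
      assume ?L
      then obtain y z where eq: "{w, y, z} = {a, b, c}" and wy: "(w, y) \<in> R" and yz: "(y, z) \<in> R" by auto
      from wy yz have "(w, z) \<in> R" using linear_orders_trans[OF R] by blast
      moreover have "(w, w) \<in> R" using linear_orders_refl[OF R] assms(2-4,6) by blast
      ultimately have "\<forall>p\<in>{w, y, z}. (w, p) \<in> R" using wy by simp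
      then show ?R unfolding eq .
    next
      assume top: ?R
      obtain y z where yz: "distinct [w, y, z]" "{a, b, c} = {w, y, z}"
        using three_set_cases assms(5,6) by metis
      then have "{w, y, z} \<subseteq> A" using assms(2-4) by auto
      \<comment> \<open>Either arrangement of the other two alternatives gives a word with
        \<open>w\<close> in front, so totality is enough.\<close>
      then have "(y, z) \<in> R \<or> (z, y) \<in> R"
        using linear_orders_not_iff[OF R, of y z] yz(1) by auto
      moreover have "(w, y) \<in> R" "(w, z) \<in> R" using top yz(2) by auto
      moreover have "distinct [w, z, y]" "{w, z, y} = {a, b, c}" using yz by auto
      ultimately show ?L using yz
        by (metis diff_self_eq_0 nth_Cons_0)
    qed
  qed
  show ?thesis
    unfolding never_condition_iff[OF assms(1-5)] never_top_def
    by (intro arg_cong[where f = Not] bex_cong refl key)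
qed

lemma never_condition_3_iff:
  assumes "D \<subseteq> linear_orders A" "a \<in> A" "b \<in> A" "c \<in> A" "distinct [a, b, c]" "w \<in> {a, b, c}"
  shows "never_condition (restrict_domain D {a, b, c}) w 3 \<longleftrightarrow> never_bottom D w {a, b, c}"
proof -
  have key: "(\<exists>x y z. distinct [x, y, z] \<and> {x, y, z} = {a, b, c} \<and>
         (x, y) \<in> R \<and> (y, z) \<in> R \<and> [x, y, z] ! (3 - 1) = w) \<longleftrightarrow> (\<forall>y\<in>{a, b, c}. (y, w) \<in> R)"
    (is "?L \<longleftrightarrow> ?R") if "R \<in> D" for R
  proof -
    have R: "R \<in> linear_orders A" using assms(1) that by auto
    show ?thesis
    proof
      assume ?L
      then obtain x y where eq: "{x, y, w} = {a, b, c}" and xy: "(x, y) \<in> R" and yw: "(y, w) \<in> R" by auto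
      from xy yw have "(x, w) \<in> R" using linear_orders_trans[OF R] by blast
      moreover have "(w, w) \<in> R" using linear_orders_refl[OF R] assms(2-4,6) by blast
      ultimately have "\<forall>p\<in>{x, y, w}. (p, w) \<in> R" using yw by simp
      then show ?R unfolding eq .
    next
      assume bot: ?R
      obtain y z where yz: "distinct [w, y, z]" "{a, b, c} = {w, y, z}"
        using three_set_cases assms(5,6) by metis
      then have "{w, y, z} \<subseteq> A" using assms(2-4) by auto
      then have "(y, z) \<in> R \<or> (z, y) \<in> R"
        using linear_orders_not_iff[OF R, of y z] yz(1) by auto
      moreover have "(y, w) \<in> R" "(z, w) \<in> R" using bot yz(2) by auto
      moreover have "distinct [y, z, w]" "{y, z, w} = {a, b, c}" "[y, z, w] ! (3 - 1) = w"
        "distinct [z, y, w]" "{z, y, w} = {a, b, c}" "[z, y, w] ! (3 - 1) = w" using yz by auto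
      ultimately show ?L by metis
    qed
  qed
  show ?thesis
    unfolding never_condition_iff[OF assms(1-5)] never_bottom_def
    by (intro arg_cong[where f = Not] bex_cong refl key)
qed

lemma never_condition_2_imp:
  assumes "D \<subseteq> linear_orders A" "a \<in> A" "b \<in> A" "c \<in> A" "distinct [a, b, c]" "w \<in> {a, b, c}"
    and "never_condition (restrict_domain D {a, b, c}) w 2"
  shows "never_middle D w {a, b, c}"
  unfolding never_middle_def
proof (rule notI, elim bexE conjE)
  fix R y z
  assume R: "R \<in> D" and "y \<in> {a, b, c} - {w}" "z \<in> {a, b, c} - {w}"
    and yz: "(y, w) \<in> R" "(w, z) \<in> R"
  then have y: "y \<in> {a, b, c}" "y \<noteq> w" and z: "z \<in> {a, b, c}" "z \<noteq> w" by auto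
  have "R \<in> linear_orders A" using assms(1) R by auto
  moreover have "y \<in> A" "w \<in> A" using assms(2-4,6) y by auto
  ultimately have "y \<noteq> z" using linear_orders_not_iff[of R A y w] y yz by auto
  then have "distinct [y, w, z]" using y z by auto
  moreover from this have "{y, w, z} = {a, b, c}" using y z assms(6) by auto
  moreover have "[y, w, z] ! (2 - 1) = w" by simp
  ultimately show False
    using assms(7) R yz unfolding never_condition_iff[OF assms(1-5)] by metis
qed

lemma peak_pit_Condorcet_domain_iff:
  "peak_pit_Condorcet_domain A D \<longleftrightarrow> D \<subseteq> linear_orders A \<and>
     (\<forall>a\<in>A. \<forall>b\<in>A. \<forall>c\<in>A. distinct [a, b, c] \<longrightarrow> peak_pit_on D {a, b, c})"
  unfolding peak_pit_Condorcet_domain_def peak_pit_on_def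
  using never_condition_1_iff[of D A] never_condition_3_iff[of D A]
  by (intro conj_cong refl ball_cong imp_cong bex_cong) simp

lemma Condorcet_domain_cases:
  assumes "Condorcet_domain A D" "a \<in> A" "b \<in> A" "c \<in> A" "distinct [a, b, c]"
  shows "peak_pit_on D {a, b, c} \<or> (\<exists>x\<in>{a, b, c}. never_middle D x {a, b, c})"
proof -
  have D: "D \<subseteq> linear_orders A" using assms(1) by (simp add: Condorcet_domain_def)
  obtain x k where x: "x \<in> {a, b, c}" and "k \<in> {1, 2, 3}"
    and nc: "never_condition (restrict_domain D {a, b, c}) x k"
    using assms unfolding Condorcet_domain_def by blast
  then consider "k = 1" | "k = 2" | "k = 3" by blast
  then show ?thesis
  proof cases
    case 1
    then show ?thesis
      using nc x never_condition_1_iff[OF D assms(2-5) x] unfolding peak_pit_on_def by blast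
  next
    case 2
    then show ?thesis using nc x never_condition_2_imp[OF D assms(2-5) x] by blast
  next
    case 3
    then show ?thesis
      using nc x never_condition_3_iff[OF D assms(2-5) x] unfolding peak_pit_on_def by blast
  qed
qed

lemma peak_pit_imp_Condorcet_domain:
  "peak_pit_Condorcet_domain A D \<Longrightarrow> Condorcet_domain A D"
  unfolding peak_pit_Condorcet_domain_def Condorcet_domain_def by blast

section \<open>Peak-pit conditions when orders are removed or added\<close>

lemma peak_pit_on_subset: "peak_pit_on D B \<Longrightarrow> E \<subseteq> D \<Longrightarrow> peak_pit_on E B"
  unfolding peak_pit_on_def never_top_def never_bottom_def by (meson subsetD)

text \<open>Being top or bottom in \<open>B\<close> depends only on the restriction to
  \<open>B\<close>, and that of \<open>S\<close> already occurs in \<open>D\<close> through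
  \<open>T\<close>.\<close>

lemma peak_pit_on_insert:
  assumes "peak_pit_on D B" "T \<in> D" "Restr S B = Restr T B"
  shows "peak_pit_on (insert S D) B"
proof -
  have "(\<forall>y\<in>B. (x, y) \<in> S) \<longleftrightarrow> (\<forall>y\<in>B. (x, y) \<in> T)"
    and "(\<forall>y\<in>B. (y, x) \<in> S) \<longleftrightarrow> (\<forall>y\<in>B. (y, x) \<in> T)" if "x \<in> B" for x
    using assms(3) that by blast+
  moreover obtain x where "x \<in> B" "never_top D x B \<or> never_bottom D x B"
    using assms(1) unfolding peak_pit_on_def by blast
  ultimately have "never_top (insert S D) x B \<or> never_bottom (insert S D) x B"
    using assms(2) unfolding never_top_def never_bottom_def by (metis insertE)
  then show ?thesis
    using \<open>x \<in> B\<close> unfolding peak_pit_on_def by blast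
qed

text \<open>
  On a triple \<open>x, y, z\<close> the orders that never rank \<open>x\<close> in the middle are \<open>xyz\<close>,
  \<open>xzy\<close>, \<open>yzx\<close>, \<open>zyx\<close>; any three of them still satisfy a peak-pit condition, so all
  four must occur here.
\<close>

lemma never_middle_not_peak_pit:
  assumes D: "D \<subseteq> linear_orders A" and A: "x \<in> A" "y \<in> A" "z \<in> A" and d: "distinct [x, y, z]"
    and nm: "never_middle D x {x, y, z}" and npp: "\<not> peak_pit_on D {x, y, z}"
  shows "\<exists>R\<in>D. (x, y) \<in> R \<and> (y, z) \<in> R" "\<exists>R\<in>D. (x, z) \<in> R \<and> (z, y) \<in> R"
    "\<exists>R\<in>D. (y, z) \<in> R \<and> (z, x) \<in> R" "\<exists>R\<in>D. (z, y) \<in> R \<and> (y, x) \<in> R"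
proof -
  note attained = npp[unfolded peak_pit_on_def never_top_def never_bottom_def]
  have mid: "\<not> ((y, x) \<in> R \<and> (x, z) \<in> R)" "\<not> ((z, x) \<in> R \<and> (x, y) \<in> R)" if "R \<in> D" for R
    using nm that d unfolding never_middle_def by auto
  obtain R where "R \<in> D" "(y, z) \<in> R" "(x, z) \<in> R" using attained by fast
  then show "\<exists>R\<in>D. (x, y) \<in> R \<and> (y, z) \<in> R"
    using mid linear_orders_not_iff[of R A x y] D A d by auto
  obtain R where "R \<in> D" "(z, y) \<in> R" "(x, y) \<in> R" using attained by fast
  then show "\<exists>R\<in>D. (x, z) \<in> R \<and> (z, y) \<in> R"
    using mid linear_orders_not_iff[of R A x z] D A d by auto
  obtain R where "R \<in> D" "(y, z) \<in> R" "(y, x) \<in> R" using attained by fast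
  then show "\<exists>R\<in>D. (y, z) \<in> R \<and> (z, x) \<in> R"
    using mid linear_orders_not_iff[of R A x z] D A d by auto
  obtain R where "R \<in> D" "(z, y) \<in> R" "(z, x) \<in> R" using attained by fast
  then show "\<exists>R\<in>D. (z, y) \<in> R \<and> (y, x) \<in> R"
    using mid linear_orders_not_iff[of R A x y] D A d by auto
qed

section \<open>Closure under pairwise majority\<close>

text \<open>The majority relation of three voters, which is also the median of three sets. For
  arbitrary linear orders it can be cyclic.\<close>

definition majority :: "'a rel \<Rightarrow> 'a rel \<Rightarrow> 'a rel \<Rightarrow> 'a rel" where
  "majority P Q T = (P \<inter> Q) \<union> (P \<inter> T) \<union> (Q \<inter> T)"

lemma Restr_eqI:
  assumes "S \<in> linear_orders A" "T \<in> linear_orders A" "B \<subseteq> A"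
    and "\<And>p q. p \<in> B \<Longrightarrow> q \<in> B \<Longrightarrow> p \<noteq> q \<Longrightarrow> (p, q) \<in> S \<longleftrightarrow> (p, q) \<in> T"
  shows "Restr S B = Restr T B"
  using assms linear_orders_refl by fast

text \<open>If \<open>x\<close> is never top, the possible orders form a path of adjacent swaps:
  \<open>yxz\<close>, \<open>yzx\<close>, \<open>zyx\<close>, \<open>zxy\<close>. If
  \<open>x\<close> is never bottom, the path is \<open>yxz\<close>, \<open>xyz\<close>,
  \<open>xzy\<close>, \<open>zxy\<close>. Each pair is swapped at most once along a path, so the
  majority of three orders is the one lying between the other two.\<close>

lemma majority_Restr:
  assumes D: "D \<subseteq> linear_orders A" and A: "a \<in> A" "b \<in> A" "c \<in> A" and d: "distinct [a, b, c]"
    and pp: "peak_pit_on D {a, b, c}" and PQT: "P \<in> D" "Q \<in> D" "T \<in> D"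
  shows "\<exists>S\<in>D. Restr (majority P Q T) {a, b, c} = Restr S {a, b, c}"
proof -
  obtain x where x: "x \<in> {a, b, c}"
    and nv: "never_top D x {a, b, c} \<or> never_bottom D x {a, b, c}"
    using pp unfolding peak_pit_on_def by blast
  obtain y z where d': "distinct [x, y, z]" and eq: "{a, b, c} = {x, y, z}"
    using three_set_cases x d by metis
  then have "{x, y, z} \<subseteq> A" using A by auto
  then have A': "x \<in> A" "y \<in> A" "z \<in> A" by auto
  \<comment> \<open>On the triple an order becomes three truth values, for \<open>(x, y)\<close>,
    \<open>(x, z)\<close> and \<open>(y, z)\<close>. \<open>tr\<close> rules out the two cyclic
    assignments, and \<open>nv'\<close> two more.\<close>
  have refl: "(x, x) \<in> R" "(y, y) \<in> R" "(z, z) \<in> R"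
    and inv: "(y, x) \<in> R \<longleftrightarrow> (x, y) \<notin> R" "(z, x) \<in> R \<longleftrightarrow> (x, z) \<notin> R" "(z, y) \<in> R \<longleftrightarrow> (y, z) \<notin> R"
    and tr: "(x, y) \<in> R \<Longrightarrow> (y, z) \<in> R \<Longrightarrow> (x, z) \<in> R" "(x, z) \<in> R \<Longrightarrow> (x, y) \<in> R \<or> (y, z) \<in> R"
    and nv': "never_top D x {x, y, z} \<Longrightarrow> \<not> ((x, y) \<in> R \<and> (x, z) \<in> R)"
      "never_bottom D x {x, y, z} \<Longrightarrow> (x, y) \<in> R \<or> (x, z) \<in> R"
    if "R \<in> D" for R
  proof -
    have R: "R \<in> linear_orders A" using that D by auto
    note n = linear_orders_not_iff[OF R] and t = linear_orders_trans[OF R]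
    show r: "(x, x) \<in> R" "(y, y) \<in> R" "(z, z) \<in> R"
      using linear_orders_refl[OF R] A' by auto
    show i: "(y, x) \<in> R \<longleftrightarrow> (x, y) \<notin> R" "(z, x) \<in> R \<longleftrightarrow> (x, z) \<notin> R" "(z, y) \<in> R \<longleftrightarrow> (y, z) \<notin> R"
      using n A' d' by auto
    show "(x, y) \<in> R \<Longrightarrow> (y, z) \<in> R \<Longrightarrow> (x, z) \<in> R" by (rule t)
    show "(x, z) \<in> R \<Longrightarrow> (x, y) \<in> R \<or> (y, z) \<in> R" using t i by blast
    show "never_top D x {x, y, z} \<Longrightarrow> \<not> ((x, y) \<in> R \<and> (x, z) \<in> R)"
      using r that unfolding never_top_def by blast
    show "never_bottom D x {x, y, z} \<Longrightarrow> (x, y) \<in> R \<or> (x, z) \<in> R"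
      using r i that unfolding never_bottom_def by blast
  qed
  have agree: "Restr (majority P Q T) {x, y, z} = Restr S {x, y, z}"
    if "S \<in> D" "(x, y) \<in> S \<longleftrightarrow> (x, y) \<in> majority P Q T"
      "(x, z) \<in> S \<longleftrightarrow> (x, z) \<in> majority P Q T" "(y, z) \<in> S \<longleftrightarrow> (y, z) \<in> majority P Q T" for S
  proof -
    have "\<forall>p\<in>{x, y, z}. \<forall>q\<in>{x, y, z}. (p, q) \<in> majority P Q T \<longleftrightarrow> (p, q) \<in> S"
      using that unfolding majority_def by (simp add: refl inv PQT) argo
    then show ?thesis by blast
  qed
  \<comment> \<open>The middle one of the three on the path; a purely propositional check.\<close>
  have "\<exists>S\<in>{P, Q, T}. ((x, y) \<in> S \<longleftrightarrow> (x, y) \<in> majority P Q T) \<and>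
      ((x, z) \<in> S \<longleftrightarrow> (x, z) \<in> majority P Q T) \<and> ((y, z) \<in> S \<longleftrightarrow> (y, z) \<in> majority P Q T)"
    using nv[unfolded eq] nv'[OF PQT(1)] nv'[OF PQT(2)] nv'[OF PQT(3)]
      tr[OF PQT(1)] tr[OF PQT(2)] tr[OF PQT(3)]
    unfolding majority_def by (simp; argo)
  then obtain S where S: "S \<in> {P, Q, T}" "(x, y) \<in> S \<longleftrightarrow> (x, y) \<in> majority P Q T"
      "(x, z) \<in> S \<longleftrightarrow> (x, z) \<in> majority P Q T" "(y, z) \<in> S \<longleftrightarrow> (y, z) \<in> majority P Q T"
    by (elim bexE conjE)
  then have "S \<in> D" using PQT by auto
  then show ?thesis
    unfolding eq using agree[OF _ S(2-4)] by (intro bexI)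
qed

text \<open>Only transitivity is at stake, and on each triple the majority coincides with an order
  of \<open>D\<close>.\<close>

lemma majority_linear_order:
  assumes pp: "peak_pit_Condorcet_domain A D" and PQT: "P \<in> D" "Q \<in> D" "T \<in> D"
  shows "majority P Q T \<in> linear_orders A"
proof (rule linear_ordersI)
  have lin: "P \<in> linear_orders A" "Q \<in> linear_orders A" "T \<in> linear_orders A"
    using assms unfolding peak_pit_Condorcet_domain_def by auto
  show "majority P Q T \<subseteq> A \<times> A"
    using lin linear_orders_subset unfolding majority_def by blast
  show "(x, x) \<in> majority P Q T" if "x \<in> A" for x
    using lin that linear_orders_refl unfolding majority_def by fast
  show "(x, y) \<notin> majority P Q T \<longleftrightarrow> (y, x) \<in> majority P Q T" if "x \<in> A" "y \<in> A" "x \<noteq> y" for x y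
    using lin that linear_orders_not_iff[of _ A x y] unfolding majority_def by blast
  show "(x, z) \<in> majority P Q T" if "x \<in> A" "y \<in> A" "z \<in> A" "distinct [x, y, z]"
    "(x, y) \<in> majority P Q T" "(y, z) \<in> majority P Q T" for x y z
  proof -
    have "D \<subseteq> linear_orders A" "peak_pit_on D {x, y, z}"
      using that(1-4) pp unfolding peak_pit_Condorcet_domain_iff by auto
    from majority_Restr[OF this(1) that(1-4) this(2) PQT]
    obtain S where S: "S \<in> D" "Restr (majority P Q T) {x, y, z} = Restr S {x, y, z}"
      by blast
    then have "(x, y) \<in> S" "(y, z) \<in> S" using that by auto
    moreover have "S \<in> linear_orders A"
      using S(1) pp unfolding peak_pit_Condorcet_domain_iff by auto
    ultimately have "(x, z) \<in> S" using linear_orders_trans by metis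
    then show ?thesis using S(2) by auto
  qed
qed

text \<open>The form in which maximality is used: membership in \<open>D\<close> is tested triple by
  triple.\<close>

lemma maximal_peak_pit_insert:
  assumes "maximal_peak_pit_Condorcet_domain A D" "S \<in> linear_orders A"
    and "\<And>a b c. a \<in> A \<Longrightarrow> b \<in> A \<Longrightarrow> c \<in> A \<Longrightarrow> distinct [a, b, c] \<Longrightarrow>
           peak_pit_on (insert S D) {a, b, c}"
  shows "S \<in> D"
proof -
  have "peak_pit_Condorcet_domain A (insert S D)"
    using assms unfolding maximal_peak_pit_Condorcet_domain_def peak_pit_Condorcet_domain_iff by simp
  then show ?thesis
    using assms(1) unfolding maximal_peak_pit_Condorcet_domain_def peak_pit_Condorcet_domain_def
    by (metis insertI1 subset_insertI)
qed

text \<open>The majority adds no new restriction to any triple, so maximality puts it into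
  \<open>D\<close>.\<close>

lemma maximal_peak_pit_majority_closed:
  assumes max: "maximal_peak_pit_Condorcet_domain A D" and PQT: "P \<in> D" "Q \<in> D" "T \<in> D"
  shows "majority P Q T \<in> D"
proof (rule maximal_peak_pit_insert[OF max])
  have pp: "peak_pit_Condorcet_domain A D"
    using max unfolding maximal_peak_pit_Condorcet_domain_def by simp
  then show "majority P Q T \<in> linear_orders A" using majority_linear_order PQT by metis
  show "peak_pit_on (insert (majority P Q T) D) {a, b, c}"
    if "a \<in> A" "b \<in> A" "c \<in> A" "distinct [a, b, c]" for a b c
  proof -
    have "D \<subseteq> linear_orders A" and ppB: "peak_pit_on D {a, b, c}"
      using that pp unfolding peak_pit_Condorcet_domain_iff by auto
    from majority_Restr[OF this(1) that this(2) PQT] show ?thesis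
      using peak_pit_on_insert[OF ppB] by metis
  qed
qed

section \<open>Swapping an adjacent pair\<close>

definition swap :: "'a \<Rightarrow> 'a \<Rightarrow> 'a rel \<Rightarrow> 'a rel" where
  "swap u v P = insert (v, u) (P - {(u, v)})"

definition adjacent :: "'a rel \<Rightarrow> 'a \<Rightarrow> 'a \<Rightarrow> bool" where
  "adjacent P u v \<longleftrightarrow> (u, v) \<in> P \<and> u \<noteq> v \<and> (\<forall>w. (u, w) \<in> P \<longrightarrow> (w, v) \<in> P \<longrightarrow> w = u \<or> w = v)"

lemma swap_linear_order:
  assumes P: "P \<in> linear_orders A" and adj: "adjacent P u v"
  shows "swap u v P \<in> linear_orders A"
proof (rule linear_ordersI)
  note n = linear_orders_not_iff[OF P] and t = linear_orders_trans[OF P]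
  have uv: "u \<in> A" "v \<in> A" "u \<noteq> v" "(u, v) \<in> P"
    using adj linear_orders_subset[OF P] unfolding adjacent_def by auto
  show "swap u v P \<subseteq> A \<times> A"
    using linear_orders_subset[OF P] uv unfolding swap_def by auto
  show "(x, x) \<in> swap u v P" if "x \<in> A" for x
    using linear_orders_refl[OF P that] uv unfolding swap_def by auto
  show "(x, y) \<notin> swap u v P \<longleftrightarrow> (y, x) \<in> swap u v P" if "x \<in> A" "y \<in> A" "x \<noteq> y" for x y
    using n[OF that] uv unfolding swap_def by auto
  show "(x, z) \<in> swap u v P" if "x \<in> A" "y \<in> A" "z \<in> A" "distinct [x, y, z]"
    "(x, y) \<in> swap u v P" "(y, z) \<in> swap u v P" for x y z
  proof -
    \<comment> \<open>Three cases: both steps come from \<open>P\<close>, or the first is the new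
      pair \<open>(v, u)\<close>, or the second is. Since nothing lies between \<open>u\<close> and
      \<open>v\<close>, a third alternative is on the same side of both.\<close>
    have "(x, y) \<in> P \<Longrightarrow> (y, z) \<in> P \<Longrightarrow> (x, z) \<in> P \<and> (x, z) \<noteq> (u, v)"
      using t that(4) adj unfolding adjacent_def by auto
    moreover have "(x, z) \<in> P \<and> (x, z) \<noteq> (u, v)" if "x = v" "y = u"
    proof -
      have "(u, z) \<in> P" "z \<noteq> v" "z \<noteq> u"
        using that \<open>(y, z) \<in> swap u v P\<close> \<open>distinct [x, y, z]\<close> unfolding swap_def by auto
      then have "(z, v) \<notin> P" using adj unfolding adjacent_def by auto
      then show ?thesis using n[of z v] \<open>z \<in> A\<close> uv \<open>z \<noteq> v\<close> that by auto
    qed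
    moreover have "(x, z) \<in> P \<and> (x, z) \<noteq> (u, v)" if "y = v" "z = u"
    proof -
      have "(x, v) \<in> P" "x \<noteq> v" "x \<noteq> u"
        using that \<open>(x, y) \<in> swap u v P\<close> \<open>distinct [x, y, z]\<close> unfolding swap_def by auto
      then have "(u, x) \<notin> P" using adj unfolding adjacent_def by auto
      then show ?thesis using n[of u x] \<open>x \<in> A\<close> uv \<open>x \<noteq> u\<close> that by auto
    qed
    ultimately show ?thesis using that(5,6) unfolding swap_def by auto
  qed
qed

text \<open>Take an inverted pair with the shortest interval in \<open>P\<close>. An alternative
  strictly inside would give two shorter intervals, whose end pairs are then not inverted, and
  transitivity of \<open>Q\<close> would put the pair itself into \<open>Q\<close>.\<close>

lemma exists_adjacent_inversion:
  assumes "finite A" and P: "P \<in> linear_orders A" and Q: "Q \<in> linear_orders A" and ne: "P - Q \<noteq> {}"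
  obtains u v where "adjacent P u v" "(u, v) \<notin> Q"
proof -
  define m where "m = (\<lambda>(u, v). card {w. (u, w) \<in> P \<and> (w, v) \<in> P})"
  obtain e where e: "e \<in> P - Q" "\<And>e'. e' \<in> P - Q \<Longrightarrow> m e \<le> m e'"
    using ne arg_min_nat_lemma[of "\<lambda>e. e \<in> P - Q" _ m] by blast
  obtain u v where uv: "e = (u, v)" by (cases e)
  note t = linear_orders_trans[OF P]
  have sub: "P \<subseteq> A \<times> A" using linear_orders_subset[OF P] .
  have uvA: "u \<in> A" "v \<in> A" "(u, v) \<in> P" "(u, v) \<notin> Q" using e uv sub by auto
  have "u \<noteq> v" using uvA linear_orders_refl[OF Q] by auto
  have "w = u \<or> w = v" if w: "(u, w) \<in> P" "(w, v) \<in> P" for w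
  proof (rule ccontr)
    assume neq: "\<not> (w = u \<or> w = v)"
    have "w \<in> A" using w sub by auto
    have refl: "(u, u) \<in> P" "(v, v) \<in> P" using linear_orders_refl[OF P] uvA by auto
    have no: "(w, u) \<notin> P" "(v, w) \<notin> P"
      using linear_orders_not_iff[OF P, of w u] linear_orders_not_iff[OF P, of v w]
        \<open>w \<in> A\<close> uvA neq w by auto
    have "finite {w. (u, w) \<in> P \<and> (w, v) \<in> P}"
      using finite_subset[OF _ \<open>finite A\<close>] sub by (metis (no_types, lifting) SigmaD1 mem_Collect_eq subset_iff)
    moreover have "{p. (u, p) \<in> P \<and> (p, w) \<in> P} \<subset> {p. (u, p) \<in> P \<and> (p, v) \<in> P}"
      using t w no uvA refl by blast
    moreover have "{p. (w, p) \<in> P \<and> (p, v) \<in> P} \<subset> {p. (u, p) \<in> P \<and> (p, v) \<in> P}"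
      using t w no uvA refl by blast
    ultimately have "m (u, w) < m (u, v)" "m (w, v) < m (u, v)"
      unfolding m_def by (auto intro: psubset_card_mono)
    then have "(u, w) \<in> Q" "(w, v) \<in> Q" using e(2) w uv by (meson DiffI not_less)+
    then show False using linear_orders_trans[OF Q] uvA by metis
  qed
  then show thesis using that uvA \<open>u \<noteq> v\<close> unfolding adjacent_def by blast
qed

text \<open>
  The only new restriction occurs on a triple \<open>u, v, w\<close> where some other pair is inverted
  as well. All inverted pairs split \<open>D\<close> in the same way, which leaves so few restrictions of
  \<open>D\<close> to the triple that the swapped order can be added.
\<close>

lemma peak_pit_on_insert_swap:
  assumes D: "D \<subseteq> linear_orders A" and P: "P \<in> D" and Q: "Q \<in> D"
    and adj: "adjacent P u v" and uvQ: "(u, v) \<notin> Q"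
    and split: "\<And>T. T \<in> D \<Longrightarrow> T \<inter> (P - Q) = {} \<or> P - Q \<subseteq> T"
    and w: "w \<in> A" "w \<noteq> u" "w \<noteq> v" and pp: "peak_pit_on D {u, v, w}"
  shows "peak_pit_on (insert (swap u v P) D) {u, v, w}"
proof -
  define S where "S = swap u v P"
  have lin: "R \<in> linear_orders A" if "R \<in> insert S D" for R
    using that D P swap_linear_order[OF _ adj] unfolding S_def by auto
  have A: "u \<in> A" "v \<in> A" "u \<noteq> v" and uvP: "(u, v) \<in> P"
    using adj lin[of P] P linear_orders_subset unfolding adjacent_def by auto
  have refl: "(u, u) \<in> R" "(v, v) \<in> R" "(w, w) \<in> R"
    and inv: "(v, u) \<in> R \<longleftrightarrow> (u, v) \<notin> R" "(w, u) \<in> R \<longleftrightarrow> (u, w) \<notin> R" "(w, v) \<in> R \<longleftrightarrow> (v, w) \<notin> R"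
    and tr: "(u, v) \<in> R \<Longrightarrow> (v, w) \<in> R \<Longrightarrow> (u, w) \<in> R" "(u, w) \<in> R \<Longrightarrow> (u, v) \<in> R \<or> (v, w) \<in> R"
    if "R \<in> insert S D" for R
    using linear_orders_refl[OF lin[OF that]] linear_orders_not_iff[OF lin[OF that]]
      linear_orders_trans[OF lin[OF that]] A w by metis+
  have S: "(u, v) \<notin> S" "(u, w) \<in> S \<longleftrightarrow> (u, w) \<in> P" "(v, w) \<in> S \<longleftrightarrow> (v, w) \<in> P"
    using A w unfolding S_def swap_def by auto
  \<comment> \<open>By adjacency \<open>w\<close> is below both \<open>u\<close> and
    \<open>v\<close> in \<open>P\<close> or above both.\<close>
  have adj': "(u, w) \<in> P \<longleftrightarrow> (v, w) \<in> P"
    using adj w inv[of P] P tr[of P] uvP unfolding adjacent_def by blast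
  \<comment> \<open>Every inverted pair splits \<open>D\<close> exactly as \<open>(u, v)\<close>
    does.\<close>
  have sp: "(u, v) \<in> T \<longleftrightarrow> (p, q) \<in> T" if "T \<in> D" "(p, q) \<in> P - Q" for T p q
    using split[OF that(1)] that(2) uvP uvQ by blast
  have top: "never_top (insert S D) x {u, v, w} \<longleftrightarrow> (\<forall>R\<in>insert S D. \<exists>y\<in>{u, v, w}. (x, y) \<notin> R)"
    and bot: "never_bottom (insert S D) x {u, v, w} \<longleftrightarrow> (\<forall>R\<in>insert S D. \<exists>y\<in>{u, v, w}. (y, x) \<notin> R)"
    for x unfolding never_top_def never_bottom_def by blast+
  \<comment> \<open>Orders of \<open>D\<close> that together put each alternative on top and each at
    the bottom contradict \<open>pp\<close>.\<close>
  have all_four: False if sub: "{R1, R2, R3, R4} \<subseteq> D" and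
    cover: "\<And>x. x \<in> {u, v, w} \<Longrightarrow> \<exists>R\<in>{R1, R2, R3, R4}. \<forall>y\<in>{u, v, w}. (x, y) \<in> R"
    "\<And>x. x \<in> {u, v, w} \<Longrightarrow> \<exists>R\<in>{R1, R2, R3, R4}. \<forall>y\<in>{u, v, w}. (y, x) \<in> R"
    for R1 R2 R3 R4
  proof -
    obtain x where x: "x \<in> {u, v, w}"
      and "never_top {R1, R2, R3, R4} x {u, v, w} \<or> never_bottom {R1, R2, R3, R4} x {u, v, w}"
      using peak_pit_on_subset[OF pp sub] unfolding peak_pit_on_def by (elim bexE)
    then show False
      using cover[OF x] unfolding never_top_def never_bottom_def by (elim disjE notE)
  qed
  note iP = inv[OF insertI2[OF P]] refl[OF insertI2[OF P]] tr[OF insertI2[OF P]]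
  note iQ = inv[OF insertI2[OF Q]] refl[OF insertI2[OF Q]] tr[OF insertI2[OF Q]]
  have "S \<in> insert S D" by simp
  note iS = inv[OF this] refl[OF this] tr[OF this]
  \<comment> \<open>These cases are exhaustive because \<open>Q\<close> has \<open>v\<close> above
    \<open>u\<close>: if \<open>w\<close> is below both in \<open>P\<close> and
    \<open>(u, w)\<close> is not inverted, then \<open>Q\<close> also has \<open>v\<close> above
    \<open>w\<close>; dually when \<open>w\<close> is above both.\<close>
  consider (agree) "(u, w) \<in> P \<longleftrightarrow> (u, w) \<in> Q" "(v, w) \<in> P \<longleftrightarrow> (v, w) \<in> Q"
    | (below) "(u, w) \<in> P" "(u, w) \<notin> Q" | (above) "(w, v) \<in> P" "(w, v) \<notin> Q"
    using iP iQ adj' uvQ by blast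
  then have "peak_pit_on (insert S D) {u, v, w}"
  proof cases
    case agree
    \<comment> \<open>On this triple \<open>P\<close> and \<open>Q\<close> differ only in the pair
      that the swap reverses.\<close>
    have "Restr S {u, v, w} = Restr Q {u, v, w}"
      by (rule Restr_eqI[of S A Q]) (use lin A w Q agree S iS iQ uvQ in auto)
    then show ?thesis using peak_pit_on_insert pp Q by metis
  next
    case below
    have uw: "(u, v) \<in> T \<longleftrightarrow> (u, w) \<in> T" if "T \<in> D" for T using sp that below by blast
    show ?thesis
    \<comment> \<open>Here \<open>P\<close> is \<open>uvw\<close> and \<open>S\<close> is
      \<open>vuw\<close>. By \<open>uw\<close>, an order of \<open>D\<close> with \<open>v\<close>
      at the bottom must be \<open>uwv\<close>, so the question is whether \<open>uwv\<close>
      occurs.\<close>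
    proof (cases "\<exists>T\<in>D. (u, w) \<in> T \<and> (w, v) \<in> T")
      case False
      then have "never_bottom (insert S D) v {u, v, w}"
        unfolding bot using uw S by auto
      then show ?thesis unfolding peak_pit_on_def by blast
    next
      case True
      then obtain T where T: "T \<in> D" "(u, w) \<in> T" "(w, v) \<in> T" by blast
      note iT = inv[OF insertI2[OF T(1)]] refl[OF insertI2[OF T(1)]] tr[OF insertI2[OF T(1)]]
      have vwQ: "(v, w) \<in> Q"
        using sp[OF T(1), of v w] T iT below adj' uw by blast
      \<comment> \<open>Now \<open>Q\<close> is \<open>vwu\<close> and \<open>T\<close> is
        \<open>uwv\<close>. A further order \<open>wvu\<close> would complete all tops and bottoms;
        by \<open>uw\<close> it is the only way to have \<open>w\<close> on top.\<close>
      have no: "False" if T': "T' \<in> D" "(w, v) \<in> T'" "(v, u) \<in> T'" for T'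
      proof -
        note iT' = inv[OF insertI2[OF T'(1)]] refl[OF insertI2[OF T'(1)]] tr[OF insertI2[OF T'(1)]]
        show False
          by (rule all_four[of P Q T T'])
            (use uvP uvQ below adj' vwQ T T' iP iQ iT iT' P Q in auto)
      qed
      have "(w, u) \<notin> R \<or> (w, v) \<notin> R" if "R \<in> D" for R
        using uw[OF that] inv[of R] no[OF that] that by blast
      then have "never_top (insert S D) w {u, v, w}"
        unfolding top using iS S below by auto
      then show ?thesis unfolding peak_pit_on_def by blast
    qed
  next
    case above
    have wv: "(u, v) \<in> T \<longleftrightarrow> (w, v) \<in> T" if "T \<in> D" for T using sp that above by blast
    show ?thesis
    \<comment> \<open>The mirror image of \<open>below\<close>: reverse all orders and exchange
      \<open>u\<close> and \<open>v\<close>. Now \<open>P\<close> is \<open>wuv\<close>,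
      \<open>S\<close> is \<open>wvu\<close>, and the order excluded by \<open>no\<close> is
      \<open>vuw\<close>.\<close>
    proof (cases "\<exists>T\<in>D. (u, w) \<in> T \<and> (w, v) \<in> T")
      case False
      then have "never_top (insert S D) u {u, v, w}"
        unfolding top using wv S by auto
      then show ?thesis unfolding peak_pit_on_def by blast
    next
      case True
      then obtain T where T: "T \<in> D" "(u, w) \<in> T" "(w, v) \<in> T" by blast
      note iT = inv[OF insertI2[OF T(1)]] refl[OF insertI2[OF T(1)]] tr[OF insertI2[OF T(1)]]
      have wuQ: "(w, u) \<in> Q"
        using sp[OF T(1), of w u] T iT iP above adj' wv by blast
      have no: "False" if T': "T' \<in> D" "(v, u) \<in> T'" "(u, w) \<in> T'" for T'
      proof -
        note iT' = inv[OF insertI2[OF T'(1)]] refl[OF insertI2[OF T'(1)]] tr[OF insertI2[OF T'(1)]]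
        show False
          by (rule all_four[of P Q T T'])
            (use uvP uvQ above adj' wuQ T T' iP iQ iT iT' P Q in auto)
      qed
      have "(u, w) \<notin> R \<or> (v, w) \<notin> R" if "R \<in> D" for R
        using wv[OF that] inv[of R] no[OF that] that by blast
      then have "never_bottom (insert S D) w {u, v, w}"
        unfolding bot using iS iP S above adj' by auto
      then show ?thesis unfolding peak_pit_on_def by blast
    qed
  qed
  then show ?thesis unfolding S_def .
qed

section \<open>Distinct splits in a maximal peak-pit domain\<close>

lemma maximal_peak_pit_splits_differ:
  assumes "finite A" and max: "maximal_peak_pit_Condorcet_domain A D"
    and "x \<noteq> y" "y \<noteq> z"
    and nonempty: "R \<in> D" "(x, y) \<in> R" "R' \<in> D" "(x, y) \<notin> R'"
  shows "\<exists>T\<in>D. \<not> ((x, y) \<in> T \<longleftrightarrow> (x, z) \<in> T)"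
proof (rule ccontr)
  assume "\<not> ?thesis"
  then have same: "(x, y) \<in> T \<longleftrightarrow> (x, z) \<in> T" if "T \<in> D" for T using that by blast
  have pp: "peak_pit_Condorcet_domain A D"
    using max unfolding maximal_peak_pit_Condorcet_domain_def by simp
  then have D: "D \<subseteq> linear_orders A" unfolding peak_pit_Condorcet_domain_def by simp
  have fin: "finite R" if "R \<in> D" for R
    using that D linear_orders_subset \<open>finite A\<close> finite_subset by (metis finite_SigmaI subsetD)
  \<comment> \<open>Pairs of orders on opposite sides of the assumed common split, measured by the
    number of inverted pairs.\<close>
  define across where "across = (\<lambda>(P, Q). P \<in> D \<and> Q \<in> D \<and> (x, y) \<in> P - Q)"
  define m where "m = (\<lambda>(P, Q). card (P - Q :: 'a rel))"
  have "across (R, R')" using nonempty by (simp add: across_def)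
  then obtain e where e: "across e" "\<And>e'. across e' \<Longrightarrow> m e \<le> m e'"
    using arg_min_nat_lemma[of across _ m] by blast
  obtain P Q where PQ: "e = (P, Q)" by (cases e)
  have P: "P \<in> D" and Q: "Q \<in> D" and xy: "(x, y) \<in> P" "(x, y) \<notin> Q"
    using e(1) PQ by (auto simp: across_def)
  \<comment> \<open>Minimal cardinality, turned into minimality under inclusion by
    finiteness.\<close>
  have min: "P' - Q' = P - Q" if "P' \<in> D" "Q' \<in> D" "(x, y) \<in> P' - Q'" "P' - Q' \<subseteq> P - Q" for P' Q'
    using e(2)[of "(P', Q')"] that fin[OF P] card_seteq[of "P - Q" "P' - Q'"]
    unfolding PQ m_def across_def by auto
  \<comment> \<open>The majority of \<open>P\<close>, \<open>Q\<close> and \<open>T\<close> lies in \<open>D\<close>, so by minimality it is \<open>P\<close> or \<open>Q\<close>.\<close>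
  have split: "T \<inter> (P - Q) = {} \<or> P - Q \<subseteq> T" if T: "T \<in> D" for T
  proof (cases "(x, y) \<in> T")
    case True
    then have "majority P Q T - Q = P - Q"
      using min[of "majority P Q T" Q] maximal_peak_pit_majority_closed[OF max P Q T] Q xy
      unfolding majority_def by blast
    then show ?thesis unfolding majority_def by blast
  next
    case False
    then have "P - majority P Q T = P - Q"
      using min[of P "majority P Q T"] maximal_peak_pit_majority_closed[OF max P Q T] P xy
      unfolding majority_def by blast
    then show ?thesis unfolding majority_def by blast
  qed
  have lin: "P \<in> linear_orders A" "Q \<in> linear_orders A" using D P Q by auto
  obtain u v where adj: "adjacent P u v" and uvQ: "(u, v) \<notin> Q"
    using exists_adjacent_inversion[OF \<open>finite A\<close> lin] xy by blast
  have uv: "u \<in> A" "v \<in> A" "u \<noteq> v" "(u, v) \<in> P"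
    using adj linear_orders_subset[OF lin(1)] unfolding adjacent_def by auto
  have "swap u v P \<in> D"
  proof (rule maximal_peak_pit_insert[OF max swap_linear_order[OF lin(1) adj]])
    fix a b c assume abc: "a \<in> A" "b \<in> A" "c \<in> A" "distinct [a, b, c]"
    have ppB: "peak_pit_on D {a, b, c}"
      using pp abc unfolding peak_pit_Condorcet_domain_iff by blast
    show "peak_pit_on (insert (swap u v P) D) {a, b, c}"
    proof (cases "u \<in> {a, b, c} \<and> v \<in> {a, b, c}")
      case True
      then have "\<exists>w. w \<noteq> u \<and> w \<noteq> v \<and> {a, b, c} = {u, v, w}"
        using abc(4) uv(3) by auto
      then obtain w where w: "w \<noteq> u" "w \<noteq> v" "{a, b, c} = {u, v, w}" by blast
      then have "w \<in> A" using abc by auto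
      then show ?thesis
        using peak_pit_on_insert_swap[OF D P Q adj uvQ split] w ppB by simp
    next
      case False
      then have "Restr (swap u v P) {a, b, c} = Restr P {a, b, c}"
        unfolding swap_def by blast
      then show ?thesis using peak_pit_on_insert ppB P by metis
    qed
  qed
  moreover have "(u, v) \<notin> swap u v P" using uv unfolding swap_def by auto
  \<comment> \<open>The swapped order lacks \<open>(u, v)\<close>, so by \<open>split\<close> it
    lacks every pair of \<open>P - Q\<close>. That set contains both \<open>(x, y)\<close> and
    \<open>(x, z)\<close>, but the swap removed only one pair from \<open>P\<close>.\<close>
  ultimately have "swap u v P \<inter> (P - Q) = {}" using split uv uvQ by blast
  moreover have "(x, z) \<in> P - Q" using same P Q xy by blast
  ultimately have "(x, y) = (u, v)" "(x, z) = (u, v)" using xy unfolding swap_def by auto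
  then show False using \<open>y \<noteq> z\<close> by simp
qed

section \<open>Equivalence of the two notions of maximality\<close>

lemma maximal_peak_pit_imp_peak_pit_maximal:
  assumes "finite A" and max: "maximal_peak_pit_Condorcet_domain A D"
  shows "peak_pit_maximal_Condorcet_domain A D"
  unfolding peak_pit_maximal_Condorcet_domain_def
proof (intro conjI allI impI)
  show pp: "peak_pit_Condorcet_domain A D"
    using max unfolding maximal_peak_pit_Condorcet_domain_def by simp
  fix D' assume D': "D' \<subseteq> linear_orders A" "Condorcet_domain A D'" "D \<subseteq> D'"
  have "R \<in> D" if R: "R \<in> D'" for R
  proof (rule maximal_peak_pit_insert[OF max])
    show "R \<in> linear_orders A" using R D' by auto
    fix a b c assume abc: "a \<in> A" "b \<in> A" "c \<in> A" "distinct [a, b, c]"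
    show "peak_pit_on (insert R D) {a, b, c}"
    proof (rule ccontr)
      assume npp: "\<not> peak_pit_on (insert R D) {a, b, c}"
      have sub: "insert R D \<subseteq> D'" using R D' by auto
      then have "\<not> peak_pit_on D' {a, b, c}"
        using npp peak_pit_on_subset by metis
      then obtain x where x: "x \<in> {a, b, c}" and "never_middle D' x {a, b, c}"
        using Condorcet_domain_cases[OF D'(2) abc] by blast
      then have nm: "never_middle (insert R D) x {a, b, c}"
        using sub unfolding never_middle_def by blast
      obtain y z where d: "distinct [x, y, z]" and eq: "{a, b, c} = {x, y, z}"
        using three_set_cases x abc(4) by metis
      then have "{x, y, z} \<subseteq> A" using abc by auto
      then have A: "x \<in> A" "y \<in> A" "z \<in> A" by auto
      have lin: "insert R D \<subseteq> linear_orders A" using sub D' by auto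
      note four = never_middle_not_peak_pit[OF lin A d nm[unfolded eq] npp[unfolded eq]]
      have n: "(y, x) \<in> T \<longleftrightarrow> (x, y) \<notin> T" "(z, x) \<in> T \<longleftrightarrow> (x, z) \<notin> T" "(z, y) \<in> T \<longleftrightarrow> (y, z) \<notin> T"
        if "T \<in> insert R D" for T
        using linear_orders_not_iff[of T A] that lin A d by auto
      \<comment> \<open>As \<open>x\<close> is never in the middle, it is above both
        \<open>y\<close> and \<open>z\<close> or below both.\<close>
      have same: "(x, y) \<in> T \<longleftrightarrow> (x, z) \<in> T" if "T \<in> insert R D" for T
        using nm[unfolded eq] n[of T] that d unfolding never_middle_def by auto
      \<comment> \<open>The two orders with \<open>x\<close> on top differ on \<open>y\<close> and
        \<open>z\<close>, so at most one of them is \<open>R\<close> and the other lies in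
        \<open>D\<close>. The same argument works below with \<open>x\<close> at the bottom.\<close>
      have "\<exists>T\<in>D. (x, y) \<in> T"
      proof -
        obtain T1 T2 where T: "T1 \<in> insert R D" "(x, y) \<in> T1" "(y, z) \<in> T1"
            "T2 \<in> insert R D" "(x, z) \<in> T2" "(z, y) \<in> T2"
          using four(1,2) by (elim bexE conjE)
        then have "T1 \<noteq> T2" using n(3) by metis
        then show ?thesis using T same by (metis insertE)
      qed
      moreover have "\<exists>T\<in>D. (x, y) \<notin> T"
      proof -
        obtain T1 T2 where T: "T1 \<in> insert R D" "(y, z) \<in> T1" "(z, x) \<in> T1"
            "T2 \<in> insert R D" "(z, y) \<in> T2" "(y, x) \<in> T2"
          using four(3,4) by (elim bexE conjE)
        then have "T1 \<noteq> T2" "(x, y) \<notin> T1" "(x, y) \<notin> T2" using n same by metis+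
        then show ?thesis using T by (metis insertE)
      qed
      ultimately show False
        using maximal_peak_pit_splits_differ[OF \<open>finite A\<close> max, of x y z] d same by auto
    qed
  qed
  then show "D' = D" using D' by blast
qed

theorem theorem2:
  fixes A :: "'a set" and D :: "'a rel set"
  assumes "finite A"
    and "Condorcet_domain A D"
  shows "peak_pit_maximal_Condorcet_domain A D \<longleftrightarrow> maximal_peak_pit_Condorcet_domain A D"
proof
  assume "peak_pit_maximal_Condorcet_domain A D"
  \<comment> \<open>Every peak-pit extension of \<open>D\<close> is in particular a Condorcet
    extension.\<close>
  then show "maximal_peak_pit_Condorcet_domain A D"
    unfolding peak_pit_maximal_Condorcet_domain_def maximal_peak_pit_Condorcet_domain_def
    using peak_pit_imp_Condorcet_domain by blast
next
  assume "maximal_peak_pit_Condorcet_domain A D"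
  then show "peak_pit_maximal_Condorcet_domain A D"
    using maximal_peak_pit_imp_peak_pit_maximal assms(1) by blast
qed

end
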